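(* Consider a persuasion environment with finite state space $\Omega$, full-support common prior $\mu_0$, and a receiver R with bias function $D$. Suppose that the sender S and R have the same preferences, $u(\omega,a)=v(\omega,a)$ for all $\omega$ and $a$. Assume that $D$ is interior and satisfies eventual learning of states. Then S gains from sequential persuasion if and only if $$V_D(\mu_0)<\sum_{\omega\in\Omega}\mu_0(\omega)\max_a\{v(\omega,a)\}.$$
   Context: Basic notation. $\Omega$ is a finite set; $\Delta(\Omega)$ is the set of probability vectors in $\mathbb{R}^\Omega$; $\Delta^o(\Omega)$ is the set of full-support beliefs; $\delta_\omega$ is the point mass at $\omega$. For a set $Y$, $\Delta(Y)$ denotes finite-support probability distributions on $Y$. Persuasion environment. R has action set $A$ and utility $u(\omega,a)$; S has utility $v(\omega,a)$. S and R share a full-support common prior $\mu_0\in\Delta^o(\Omega)$. For every $\mu\in\Delta(\Omega)$, $\hat a(\mu)$ denotes an action maximizing $\mathbb{E}_{\omega\sim\mu}[u(\omega,a)]$ over $a\in A$ (a maximizer is assumed to exist); if R is indifferent, the S-optimal one among the maximizers is chosen. Bias. A bias function is a map $D:\Delta^o(\Omega)\times\Delta(\Omega)\to\Delta(\Omega)$; $D(\nu,\nu')$ is the belief R holds given prior $\nu$ and Bayesian posterior $\nu'$. Let $D^1(\nu,\nu')=D(\nu,\nu')$ and $D^n(\nu,\nu')=D(D^{n-1}(\nu,\nu'),\nu')$ for $n>1$. - $D$ is interior if $D(\nu,\nu')\in\Delta^o(\Omega)$ for all $\nu\in\Delta^o(\Omega)$, $\nu'\in\Delta(\Omega)$. -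 $D$ satisfies eventual learning of states if $\lim_n D^n(\nu,\delta_\omega)=\delta_\omega$ for all $\nu\in\Delta^o(\Omega)$, $\omega\in\Omega$. One-shot persuasion. S's optimal payoff with a single signal is $$V_D(\mu_0)=\max_\tau \sum_{\mu\in Supp(\tau)}\tau(\mu)\,\mathbb{E}_{\omega\sim\mu}[v(\omega,\hat a(D(\mu_0,\mu)))]\quad\text{s.t. } \sum_{\mu\in Supp(\tau)}\tau(\mu)\mu=\mu_0,$$ over finite-support $\tau\in\Delta(\Delta(\Omega))$; the maximum is assumed to be attained. Sequential persuasion. $X$ is a (sufficiently rich, e.g. infinite) set of signals; an information structure is a map $\Omega\to\Delta(X)$. A sequential persuasion strategy $\sigma$ specifies, as a function of the history $(x_1,\ldots,x_{n-1})$ of realized signals, either an information structure $\sigma_{x_1,\ldots,x_{n-1}}$ to be used next or termination; persuasion must terminate in finite time (the length may depend on realizations). R's belief starts at $\mu_0$ and is updated recursively: $\mu^\sigma(x_1,\ldots,x_n)=D(\mu^\sigma(x_1,\ldots,x_{n-1}),\mu)$, where $\mu$ is the Bayesian posterior computed from prior $\mu^\sigma(x_1,\ldots,x_{n-1})$, the information structure $\sigma_{x_1,\ldots,x_{n-1}}$ and the realized signal $x_n$ (with $\mu^\sigma(\emptyset)=\mu_0$). Conditional on state $\omega$, a signal sequence has probability $\prod_{k}\sigma_{x_1,\ldots,x_{k-1}}(x_k|\omega)$. S's payoff from $\sigma$ is the expectation, over $\omega\sim\mu_0$ and the terminal signal sequence, of $v(\omega,\hat a(\mu'))$, where $\mu'$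 is R's final belief. S gains from sequential persuasion if there is a sequential persuasion strategy whose payoff to S is strictly higher than $V_D(\mu_0)$. *)

theory Defs
  imports "HOL-Probability.Probability"
begin

definition beliefs :: "(real ^ 'w::finite) set" where
  "beliefs = {\<mu>. (\<forall>\<omega>. 0 \<le> \<mu> $ \<omega>) \<and> (\<Sum>\<omega>\<in>UNIV. \<mu> $ \<omega>) = 1}"

definition full_support_beliefs :: "(real ^ 'w::finite) set" where
  "full_support_beliefs = {\<mu> \<in> beliefs. \<forall>\<omega>. 0 < \<mu> $ \<omega>}"

definition point_belief :: "'w::finite \<Rightarrow> real ^ 'w" where
  "point_belief \<omega> = axis \<omega> 1"

definition belief_expectation :: "real ^ 'w::finite \<Rightarrow> ('w \<Rightarrow> real) \<Rightarrow> real" where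
  "belief_expectation \<mu> f = (\<Sum>\<omega>\<in>UNIV. \<mu> $ \<omega> * f \<omega>)"


definition best_responses ::
    "'a set \<Rightarrow> ('w::finite \<Rightarrow> 'a \<Rightarrow> real) \<Rightarrow> real ^ 'w \<Rightarrow> 'a set" where
  "best_responses A u \<mu> = {a \<in> A. \<forall>b\<in>A.
     belief_expectation \<mu> (\<lambda>\<omega>. u \<omega> b) \<le> belief_expectation \<mu> (\<lambda>\<omega>. u \<omega> a)}"

text \<open>
  Since the chosen action depends on the receiver's belief \<open>\<mu>\<close> alone, ties are broken by
  the sender's expected utility at that same belief.  The predicate includes the assumption
  that a maximizer exists at every belief.
\<close>

definition receiver_choice ::
    "'a set \<Rightarrow> ('w::finite \<Rightarrow> 'a \<Rightarrow> real) \<Rightarrow> ('w \<Rightarrow> 'a \<Rightarrow> real) \<Rightarrow> (real ^ 'w \<Rightarrow> 'a) \<Rightarrow> bool" where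
  "receiver_choice A u v ahat \<longleftrightarrow> (\<forall>\<mu>\<in>beliefs. ahat \<mu> \<in> best_responses A u \<mu> \<and>
     (\<forall>b\<in>best_responses A u \<mu>.
        belief_expectation \<mu> (\<lambda>\<omega>. v \<omega> b) \<le> belief_expectation \<mu> (\<lambda>\<omega>. v \<omega> (ahat \<mu>))))"


type_synonym 'w bias = "real ^ 'w \<Rightarrow> real ^ 'w \<Rightarrow> real ^ 'w"

definition bias_function :: "'w::finite bias \<Rightarrow> bool" where
  "bias_function D \<longleftrightarrow> (\<forall>\<nu>\<in>full_support_beliefs. \<forall>\<nu>'\<in>beliefs. D \<nu> \<nu>' \<in> beliefs)"

definition interior_bias :: "'w::finite bias \<Rightarrow> bool" where
  "interior_bias D \<longleftrightarrow>
     (\<forall>\<nu>\<in>full_support_beliefs. \<forall>\<nu>'\<in>beliefs. D \<nu> \<nu>' \<in> full_support_beliefs)"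

definition bias_iterate :: "'w::finite bias \<Rightarrow> nat \<Rightarrow> 'w bias" where
  "bias_iterate D n \<nu> \<nu>' = ((\<lambda>\<rho>. D \<rho> \<nu>') ^^ n) \<nu>"

definition eventual_learning_of_states :: "'w::finite bias \<Rightarrow> bool" where
  "eventual_learning_of_states D \<longleftrightarrow> (\<forall>\<nu>\<in>full_support_beliefs. \<forall>\<omega>.
     (\<lambda>n. bias_iterate D n \<nu> (point_belief \<omega>)) \<longlonglongrightarrow> point_belief \<omega>)"


definition feasible_one_shot :: "real ^ 'w::finite \<Rightarrow> (real ^ 'w) pmf set" where
  "feasible_one_shot \<mu>0 = {\<tau>. finite (set_pmf \<tau>) \<and> set_pmf \<tau> \<subseteq> beliefs \<and>
     (\<Sum>\<mu>\<in>set_pmf \<tau>. pmf \<tau> \<mu> *\<^sub>R \<mu>) = \<mu>0}"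

definition one_shot_payoff ::
    "'w::finite bias \<Rightarrow> ('w \<Rightarrow> 'a \<Rightarrow> real) \<Rightarrow> (real ^ 'w \<Rightarrow> 'a) \<Rightarrow> real ^ 'w \<Rightarrow> (real ^ 'w) pmf \<Rightarrow> real" where
  "one_shot_payoff D v ahat \<mu>0 \<tau> =
     (\<Sum>\<mu>\<in>set_pmf \<tau>. pmf \<tau> \<mu> * belief_expectation \<mu> (\<lambda>\<omega>. v \<omega> (ahat (D \<mu>0 \<mu>))))"

definition one_shot_max_attained ::
    "'w::finite bias \<Rightarrow> ('w \<Rightarrow> 'a \<Rightarrow> real) \<Rightarrow> (real ^ 'w \<Rightarrow> 'a) \<Rightarrow> real ^ 'w \<Rightarrow> bool" where
  "one_shot_max_attained D v ahat \<mu>0 \<longleftrightarrow>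
     (\<exists>\<tau>\<in>feasible_one_shot \<mu>0. \<forall>\<tau>'\<in>feasible_one_shot \<mu>0.
        one_shot_payoff D v ahat \<mu>0 \<tau>' \<le> one_shot_payoff D v ahat \<mu>0 \<tau>)"

text \<open>The supremum below is the maximum when \<^const>\<open>one_shot_max_attained\<close> holds.\<close>

definition one_shot_value ::
    "'w::finite bias \<Rightarrow> ('w \<Rightarrow> 'a \<Rightarrow> real) \<Rightarrow> (real ^ 'w \<Rightarrow> 'a) \<Rightarrow> real ^ 'w \<Rightarrow> real" where
  "one_shot_value D v ahat \<mu>0 =
     (SUP \<tau>\<in>feasible_one_shot \<mu>0. one_shot_payoff D v ahat \<mu>0 \<tau>)"


type_synonym ('w, 'x) info_structure = "'w \<Rightarrow> 'x pmf"

text \<open>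
  A strategy maps a history of signals, oldest first, to the next information structure;
  \<^const>\<open>None\<close> stands for termination.
\<close>

type_synonym ('w, 'x) strategy = "'x list \<Rightarrow> ('w, 'x) info_structure option"

definition info_structure_on :: "'x set \<Rightarrow> ('w, 'x) info_structure \<Rightarrow> bool" where
  "info_structure_on X I \<longleftrightarrow> (\<forall>\<omega>. finite (set_pmf (I \<omega>)) \<and> set_pmf (I \<omega>) \<subseteq> X)"

text \<open>The histories that occur with positive probability in state \<open>\<omega>\<close>, terminal or not.\<close>

definition possible_history :: "('w, 'x) strategy \<Rightarrow> 'w \<Rightarrow> 'x list \<Rightarrow> bool" where
  "possible_history \<sigma> \<omega> h \<longleftrightarrow>
     (\<forall>k<length h. \<exists>I. \<sigma> (take k h) = Some I \<and> h ! k \<in> set_pmf (I \<omega>))"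

text \<open>
  Termination in finite time: in no state is there an infinite sequence of signals all of
  whose initial segments are possible.  The number of rounds may depend on the realizations.
\<close>

definition terminates :: "('w, 'x) strategy \<Rightarrow> bool" where
  "terminates \<sigma> \<longleftrightarrow>
     (\<forall>\<omega>. \<forall>x :: nat \<Rightarrow> 'x. \<exists>n. \<not> possible_history \<sigma> \<omega> (map x [0..<n]))"

definition persuasion_strategy :: "'x set \<Rightarrow> ('w, 'x) strategy \<Rightarrow> bool" where
  "persuasion_strategy X \<sigma> \<longleftrightarrow>
     (\<forall>h\<in>lists X. \<forall>I. \<sigma> h = Some I \<longrightarrow> info_structure_on X I) \<and> terminates \<sigma>"

definition terminal_histories :: "('w, 'x) strategy \<Rightarrow> 'w \<Rightarrow> 'x list set" where
  "terminal_histories \<sigma> \<omega> = {h. possible_history \<sigma> \<omega> h \<and> \<sigma> h = None}"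

definition history_prob :: "('w, 'x) strategy \<Rightarrow> 'w \<Rightarrow> 'x list \<Rightarrow> real" where
  "history_prob \<sigma> \<omega> h = (\<Prod>k<length h. pmf (the (\<sigma> (take k h)) \<omega>) (h ! k))"

definition bayes_posterior ::
    "real ^ 'w::finite \<Rightarrow> ('w, 'x) info_structure \<Rightarrow> 'x \<Rightarrow> real ^ 'w" where
  "bayes_posterior \<nu> I x =
     (\<chi> \<omega>. \<nu> $ \<omega> * pmf (I \<omega>) x / (\<Sum>\<omega>'\<in>UNIV. \<nu> $ \<omega>' * pmf (I \<omega>') x))"

fun receiver_belief ::
    "'w::finite bias \<Rightarrow> real ^ 'w \<Rightarrow> ('w, 'x) strategy \<Rightarrow> 'x list \<Rightarrow> real ^ 'w" where
  "receiver_belief D \<mu>0 \<sigma> h =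
     (if h = [] then \<mu>0
      else let \<nu> = receiver_belief D \<mu>0 \<sigma> (butlast h)
           in D \<nu> (bayes_posterior \<nu> (the (\<sigma> (butlast h))) (last h)))"

declare receiver_belief.simps [simp del]

lemma finite_possible_histories:
  fixes \<sigma> :: "('w, 'x) strategy"
  assumes "persuasion_strategy X \<sigma>"
  shows "finite {h. possible_history \<sigma> \<omega> h}"
proof (rule ccontr)
  assume inf: "infinite {h. possible_history \<sigma> \<omega> h}"
  define E where "E h = {g. possible_history \<sigma> \<omega> g \<and> (\<exists>t. g = h @ t)}" for h
  have prefix: "possible_history \<sigma> \<omega> h" if "possible_history \<sigma> \<omega> (h @ t)" for h t
    unfolding possible_history_def
  proof (intro allI impI)
    fix k assume k: "k < length h"
    then show "\<exists>I. \<sigma> (take k h) = Some I \<and> h ! k \<in> set_pmf (I \<omega>)"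
      using that[unfolded possible_history_def, rule_format, of k]
      by (simp add: nth_append)
  qed
  have inX: "h \<in> lists X" if "possible_history \<sigma> \<omega> h" for h
    using that
  proof (induction h rule: rev_induct)
    case (snoc x h)
    have h: "h \<in> lists X" using snoc prefix by blast
    obtain I where "\<sigma> h = Some I" "x \<in> set_pmf (I \<omega>)"
      using snoc.prems[unfolded possible_history_def, rule_format, of "length h"] by auto
    then have "x \<in> X"
      using assms h unfolding persuasion_strategy_def info_structure_on_def by blast
    then show ?case using h by simp
  qed simp
  have step: "\<exists>x. infinite (E (h @ [x]))" if E: "infinite (E h)" for h
  proof -
    obtain g where "g \<in> E h" using E infinite_imp_nonempty by blast
    then have h: "possible_history \<sigma> \<omega> h" using prefix unfolding E_def by blast
    define S where "S = (case \<sigma> h of None \<Rightarrow> {} | Some I \<Rightarrow> set_pmf (I \<omega>))"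
    have S: "finite S"
      using inX[OF h] assms
      by (auto simp: S_def persuasion_strategy_def info_structure_on_def split: option.split)
    have "E h \<subseteq> insert h (\<Union>x\<in>S. E (h @ [x]))"
    proof
      fix g assume "g \<in> E h"
      then obtain t where g: "possible_history \<sigma> \<omega> g" "g = h @ t" unfolding E_def by blast
      show "g \<in> insert h (\<Union>x\<in>S. E (h @ [x]))"
      proof (cases t)
        case (Cons x t')
        obtain I where "\<sigma> h = Some I" "x \<in> set_pmf (I \<omega>)"
          using g(1)[unfolded possible_history_def, rule_format, of "length h"] g(2) Cons by auto
        then have "x \<in> S" by (simp add: S_def)
        moreover have "g \<in> E (h @ [x])" using g Cons by (simp add: E_def)
        ultimately show ?thesis by blast
      qed (use g in simp)
    qed
    then show ?thesis
      using E S by (meson finite_UN_I finite_insert finite_subset)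
  qed
  have "E [] = {h. possible_history \<sigma> \<omega> h}" by (simp add: E_def)
  then have E0: "infinite (E [])" using inf by simp
  define f where "f = rec_nat [] (\<lambda>_ h. h @ [SOME x. infinite (E (h @ [x]))])"
  define x where "x n = (SOME x. infinite (E (f n @ [x])))" for n
  have f_0: "f 0 = []" by (simp add: f_def)
  have f_Suc: "f (Suc n) = f n @ [x n]" for n
    unfolding x_def by (simp add: f_def)
  have f_map: "f n = map x [0..<n]" for n
    by (induction n) (simp_all add: f_Suc f_0)
  have "infinite (E (f n))" for n
  proof (induction n)
    case (Suc n)
    show ?case using someI_ex[OF step[OF Suc]] unfolding f_Suc x_def .
  qed (simp add: f_0 E0)
  then have "E (f n) \<noteq> {}" for n
    by (metis finite.emptyI)
  then have "possible_history \<sigma> \<omega> (map x [0..<n])" for n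
    using prefix unfolding E_def f_map[symmetric] by blast
  then show False
    using assms unfolding persuasion_strategy_def terminates_def by blast
qed

text \<open>The inner sum in the following definition is therefore finite.\<close>

corollary finite_terminal_histories:
  "persuasion_strategy X \<sigma> \<Longrightarrow> finite (terminal_histories \<sigma> \<omega>)"
  by (rule finite_subset[OF _ finite_possible_histories[of X \<sigma> \<omega>]])
    (auto simp: terminal_histories_def)

definition sequential_payoff ::
    "'w::finite bias \<Rightarrow> ('w \<Rightarrow> 'a \<Rightarrow> real) \<Rightarrow> (real ^ 'w \<Rightarrow> 'a) \<Rightarrow> real ^ 'w \<Rightarrow> ('w, 'x) strategy \<Rightarrow> real" where
  "sequential_payoff D v ahat \<mu>0 \<sigma> = belief_expectation \<mu>0 (\<lambda>\<omega>.
     \<Sum>h\<in>terminal_histories \<sigma> \<omega>.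
       history_prob \<sigma> \<omega> h * v \<omega> (ahat (receiver_belief D \<mu>0 \<sigma> h)))"

definition gains_from_sequential_persuasion ::
    "'x set \<Rightarrow> 'w::finite bias \<Rightarrow> ('w \<Rightarrow> 'a \<Rightarrow> real) \<Rightarrow> (real ^ 'w \<Rightarrow> 'a) \<Rightarrow> real ^ 'w \<Rightarrow> bool" where
  "gains_from_sequential_persuasion X D v ahat \<mu>0 \<longleftrightarrow>
     (\<exists>\<sigma>. persuasion_strategy X \<sigma> \<and>
        one_shot_value D v ahat \<mu>0 < sequential_payoff D v ahat \<mu>0 \<sigma>)"

end

(* With common preferences, no strategy beats choosing the best action in every state.
   Conversely, if states are revealed fully n times, the receiver's belief in state w is
   D^n(mu0, delta_w), which tends to delta_w.  Utilities are bounded above in every state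
   because a best response to every point belief exists, so the state-wise loss of the optimal action at a
   belief mu is at most 1/mu(w) times the expected loss at mu of the action that is optimal in
   state w, and the latter vanishes as mu tends to delta_w.  Hence the payoffs from repeated
   revelation tend to the full-information payoff. *)

theory Submission
  imports Defs
begin

section \<open>Beliefs and the receiver's optimal action\<close>

lemma point_belief_in_beliefs: "point_belief \<omega> \<in> beliefs"
  by (simp add: beliefs_def point_belief_def axis_def)

lemma belief_expectation_point_belief: "belief_expectation (point_belief \<omega>) f = f \<omega>"
  by (simp add: belief_expectation_def point_belief_def axis_def if_distrib[of "\<lambda>x. x * _"] cong: if_cong)

lemma full_support_beliefs_subset_beliefs: "full_support_beliefs \<subseteq> beliefs"
  by (auto simp: full_support_beliefs_def)

lemma tendsto_belief_expectation:
  assumes "(f \<longlongrightarrow> \<mu>) F"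
  shows "((\<lambda>x. belief_expectation (f x) g) \<longlongrightarrow> belief_expectation \<mu> g) F"
  unfolding belief_expectation_def by (intro tendsto_intros assms)

lemma receiver_choice_mem:
  "receiver_choice A u v ahat \<Longrightarrow> \<mu> \<in> beliefs \<Longrightarrow> ahat \<mu> \<in> A"
  by (auto simp: receiver_choice_def best_responses_def)

lemma receiver_choice_optimal:
  assumes "receiver_choice A u v ahat" "\<mu> \<in> beliefs" "b \<in> A"
  shows "belief_expectation \<mu> (\<lambda>\<omega>. u \<omega> b) \<le> belief_expectation \<mu> (\<lambda>\<omega>. u \<omega> (ahat \<mu>))"
  using assms by (auto simp: receiver_choice_def best_responses_def)

text \<open>Expected utility at a point belief is utility in that single state. Hence the best
  utility in each state is attained, which makes the full-information payoff finite.\<close>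

lemma receiver_choice_point_belief_optimal:
  assumes "receiver_choice A u v ahat" "b \<in> A"
  shows "u \<omega> b \<le> u \<omega> (ahat (point_belief \<omega>))"
  using receiver_choice_optimal[OF assms(1) point_belief_in_beliefs assms(2)]
  by (simp add: belief_expectation_point_belief)

section \<open>Histories and their probabilities\<close>

lemma possible_history_Nil: "possible_history \<sigma> \<omega> []"
  by (simp add: possible_history_def)

lemma possible_history_snoc:
  "possible_history \<sigma> \<omega> (h @ [x]) \<longleftrightarrow>
     possible_history \<sigma> \<omega> h \<and> (\<exists>I. \<sigma> h = Some I \<and> x \<in> set_pmf (I \<omega>))"
  unfolding possible_history_def
  by (auto simp: All_less_Suc nth_append)

text \<open>\<open>persuasion_strategy\<close> restricts information structures only at histories in
  \<open>lists X\<close>; this makes the restriction available at every history that can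
  occur.\<close>

lemma possible_history_in_lists:
  assumes "persuasion_strategy X \<sigma>" "possible_history \<sigma> \<omega> h"
  shows "h \<in> lists X"
  using assms(2)
proof (induction h rule: rev_induct)
  case (snoc x h)
  then show ?case
    using assms(1)
    by (fastforce simp: possible_history_snoc persuasion_strategy_def info_structure_on_def)
qed simp

lemma history_prob_Nil: "history_prob \<sigma> \<omega> [] = 1"
  by (simp add: history_prob_def)

lemma history_prob_snoc:
  "history_prob \<sigma> \<omega> (h @ [x]) = history_prob \<sigma> \<omega> h * pmf (the (\<sigma> h) \<omega>) x"
  by (simp add: history_prob_def nth_append)

lemma history_prob_nonneg: "0 \<le> history_prob \<sigma> \<omega> h"
  by (simp add: history_prob_def prod_nonneg)

text \<open>
  Summing the probabilities of all possible histories in two ways: every nonempty possible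
  history uniquely extends a nonterminal one, and the extensions of a nonterminal history
  together have its probability.  So all but the terminal histories and the empty history cancel.
\<close>

lemma sum_history_prob_terminal:
  fixes \<sigma> :: "('w, 'x) strategy"
  assumes "persuasion_strategy X \<sigma>"
  shows "(\<Sum>h\<in>terminal_histories \<sigma> \<omega>. history_prob \<sigma> \<omega> h) = 1"
proof -
  let ?P = "history_prob \<sigma> \<omega>"
  define H where "H = {h. possible_history \<sigma> \<omega> h}"
  define N where "N = {h \<in> H. \<sigma> h \<noteq> None}"
  define S where "S h = set_pmf (the (\<sigma> h) \<omega>)" for h
  have H: "finite H" unfolding H_def by (rule finite_possible_histories[OF assms])
  then have N: "finite N" by (simp add: N_def)
  have S: "finite (S h)" if "h \<in> N" for h
    using that possible_history_in_lists[OF assms, of \<omega> h] assms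
    by (auto simp: N_def H_def S_def persuasion_strategy_def info_structure_on_def)
  have bij: "bij_betw (\<lambda>(h, x). h @ [x]) (Sigma N S) (H - {[]})"
    unfolding bij_betw_def
  proof
    show "inj_on (\<lambda>(h, x). h @ [x]) (Sigma N S)" by (auto simp: inj_on_def)
    show "(\<lambda>(h, x). h @ [x]) ` Sigma N S = H - {[]}"
    proof
      show "(\<lambda>(h, x). h @ [x]) ` Sigma N S \<subseteq> H - {[]}"
        by (auto simp: N_def H_def S_def possible_history_snoc)
      show "H - {[]} \<subseteq> (\<lambda>(h, x). h @ [x]) ` Sigma N S"
      proof
        fix g assume g: "g \<in> H - {[]}"
        then obtain h x where hx: "g = h @ [x]" by (cases g rule: rev_cases) auto
        then have "(h, x) \<in> Sigma N S"
          using g by (auto simp: N_def H_def S_def possible_history_snoc)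
        then show "g \<in> (\<lambda>(h, x). h @ [x]) ` Sigma N S" using hx by force
      qed
    qed
  qed
  have "sum ?P (H - {[]}) = (\<Sum>(h, x)\<in>Sigma N S. ?P (h @ [x]))"
    using sum.reindex_bij_betw[OF bij, of ?P] by (simp add: case_prod_unfold)
  also have "\<dots> = (\<Sum>h\<in>N. \<Sum>x\<in>S h. ?P (h @ [x]))"
    using N S by (subst sum.Sigma) auto
  also have "\<dots> = sum ?P N"
  proof (rule sum.cong)
    fix h assume "h \<in> N"
    then have "(\<Sum>x\<in>S h. pmf (the (\<sigma> h) \<omega>) x) = 1"
      using S by (intro sum_pmf_eq_1) (auto simp: S_def)
    then show "(\<Sum>x\<in>S h. ?P (h @ [x])) = ?P h"
      by (simp add: history_prob_snoc flip: sum_distrib_left)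
  qed simp
  finally have "sum ?P (H - {[]}) = sum ?P N" .
  moreover have "sum ?P H = 1 + sum ?P (H - {[]})"
    using H by (subst sum.remove[of _ "[]"]) (simp_all add: H_def possible_history_Nil history_prob_Nil)
  moreover have "sum ?P H = sum ?P N + sum ?P (terminal_histories \<sigma> \<omega>)"
  proof -
    have "H = N \<union> terminal_histories \<sigma> \<omega>" "N \<inter> terminal_histories \<sigma> \<omega> = {}"
      by (auto simp: N_def H_def terminal_histories_def)
    then show ?thesis
      using sum.union_disjoint[OF N finite_terminal_histories[OF assms, of \<omega>], of ?P] by simp
  qed
  ultimately show ?thesis by simp
qed

section \<open>Belief updating along a history\<close>

text \<open>One state in which \<open>x\<close> can occur suffices: full support gives it positive
  weight, so the denominator is positive and the division is a genuine normalization.\<close>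

lemma bayes_posterior_in_beliefs:
  assumes "\<nu> \<in> full_support_beliefs" "x \<in> set_pmf (I \<omega>)"
  shows "bayes_posterior \<nu> I x \<in> beliefs"
proof -
  have nonneg: "0 \<le> \<nu> $ \<omega>' * pmf (I \<omega>') x" for \<omega>'
    using assms(1) by (simp add: full_support_beliefs_def less_imp_le)
  have "0 < \<nu> $ \<omega> * pmf (I \<omega>) x"
    using assms by (simp add: full_support_beliefs_def pmf_positive)
  then have "0 < (\<Sum>\<omega>'\<in>UNIV. \<nu> $ \<omega>' * pmf (I \<omega>') x)"
    using nonneg by (intro sum_pos2[of UNIV \<omega>]) auto
  then show ?thesis
    using nonneg by (simp add: beliefs_def bayes_posterior_def flip: sum_divide_distrib)
qed

text \<open>By injectivity the signal \<open>s \<omega>\<close> has likelihood 1 in state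
  \<open>\<omega>\<close> and 0 elsewhere, so the posterior is the same for every full-support
  prior.\<close>

lemma bayes_posterior_revealing:
  assumes "\<nu> \<in> full_support_beliefs" "inj s"
  shows "bayes_posterior \<nu> (\<lambda>\<omega>. return_pmf (s \<omega>)) (s \<omega>) = point_belief \<omega>"
proof -
  have "\<nu> $ \<omega> \<noteq> 0" using assms(1) by (auto simp: full_support_beliefs_def less_le)
  moreover have "\<nu> $ \<omega>' * pmf (return_pmf (s \<omega>')) (s \<omega>) = (if \<omega>' = \<omega> then \<nu> $ \<omega> else 0)" for \<omega>'
    using assms(2) by (auto simp: inj_eq)
  ultimately show ?thesis
    by (simp add: bayes_posterior_def point_belief_def axis_def vec_eq_iff)
qed

lemma receiver_belief_Nil: "receiver_belief D \<mu>0 \<sigma> [] = \<mu>0"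
  by (simp add: receiver_belief.simps)

lemma receiver_belief_snoc:
  "receiver_belief D \<mu>0 \<sigma> (h @ [x]) =
     D (receiver_belief D \<mu>0 \<sigma> h) (bayes_posterior (receiver_belief D \<mu>0 \<sigma> h) (the (\<sigma> h)) x)"
  by (subst receiver_belief.simps) (simp add: Let_def)

text \<open>The properties of \<open>D\<close> concern full-support priors only. Interiority
  preserves this condition from round to round, as signals of positive probability have genuine
  posteriors.\<close>

lemma receiver_belief_full_support:
  assumes "interior_bias D" "\<mu>0 \<in> full_support_beliefs" "possible_history \<sigma> \<omega> h"
  shows "receiver_belief D \<mu>0 \<sigma> h \<in> full_support_beliefs"
  using assms(3)
proof (induction h rule: rev_induct)
  case Nil
  then show ?case using assms(2) by (simp add: receiver_belief_Nil)
next
  case (snoc x h)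
  then obtain I where "possible_history \<sigma> \<omega> h" "\<sigma> h = Some I" "x \<in> set_pmf (I \<omega>)"
    by (auto simp: possible_history_snoc)
  then show ?case
    using assms(1) snoc.IH bayes_posterior_in_beliefs[of _ x I \<omega>]
    by (simp add: receiver_belief_snoc interior_bias_def)
qed

lemma bias_iterate_full_support:
  assumes "interior_bias D" "\<nu> \<in> full_support_beliefs" "\<nu>' \<in> beliefs"
  shows "bias_iterate D n \<nu> \<nu>' \<in> full_support_beliefs"
  using assms by (induction n) (simp_all add: bias_iterate_def interior_bias_def)

section \<open>Upper bound for all strategies\<close>

text \<open>In each state the payoff is an average over terminal histories, with weights summing to
  1, of numbers at most \<open>m \<omega>\<close>.\<close>

lemma sequential_payoff_le:
  fixes D :: "'w::finite bias" and \<sigma> :: "('w, 'x) strategy"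
  assumes "persuasion_strategy X \<sigma>" "interior_bias D" "\<mu>0 \<in> full_support_beliefs"
    and bound: "\<And>\<omega> \<mu>. \<mu> \<in> beliefs \<Longrightarrow> v \<omega> (ahat \<mu>) \<le> m \<omega>"
  shows "sequential_payoff D v ahat \<mu>0 \<sigma> \<le> belief_expectation \<mu>0 m"
  unfolding sequential_payoff_def belief_expectation_def
proof (intro sum_mono mult_left_mono)
  fix \<omega>
  have "(\<Sum>h\<in>terminal_histories \<sigma> \<omega>. history_prob \<sigma> \<omega> h * v \<omega> (ahat (receiver_belief D \<mu>0 \<sigma> h)))
      \<le> (\<Sum>h\<in>terminal_histories \<sigma> \<omega>. history_prob \<sigma> \<omega> h * m \<omega>)"
  proof (intro sum_mono mult_left_mono bound history_prob_nonneg)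
    fix h assume "h \<in> terminal_histories \<sigma> \<omega>"
    then show "receiver_belief D \<mu>0 \<sigma> h \<in> beliefs"
      using receiver_belief_full_support[OF assms(2,3)] full_support_beliefs_subset_beliefs
      by (auto simp: terminal_histories_def)
  qed
  also have "\<dots> = m \<omega>"
    by (simp add: sum_history_prob_terminal[OF assms(1)] flip: sum_distrib_right)
  finally show "(\<Sum>h\<in>terminal_histories \<sigma> \<omega>.
      history_prob \<sigma> \<omega> h * v \<omega> (ahat (receiver_belief D \<mu>0 \<sigma> h))) \<le> m \<omega>" .
  show "0 \<le> \<mu>0 $ \<omega>" using assms(3) by (simp add: full_support_beliefs_def less_imp_le)
qed

section \<open>Repeated full revelation\<close>

text \<open>For injective \<open>s\<close> every round reveals the state. Later rounds would teach a
  Bayesian nothing, but each applies the bias once more.\<close>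

definition repeated_revelation :: "('w \<Rightarrow> 'x) \<Rightarrow> nat \<Rightarrow> ('w, 'x) strategy" where
  "repeated_revelation s N h = (if length h < N then Some (\<lambda>\<omega>. return_pmf (s \<omega>)) else None)"

lemma possible_history_repeated_revelation:
  "possible_history (repeated_revelation s N) \<omega> h \<longleftrightarrow>
     length h \<le> N \<and> set h \<subseteq> {s \<omega>}"
proof (induction h rule: rev_induct)
  case (snoc x h)
  then show ?case
    by (auto simp: possible_history_snoc repeated_revelation_def[of s N h])
qed (simp add: possible_history_Nil)

lemma persuasion_strategy_repeated_revelation:
  assumes "range s \<subseteq> X"
  shows "persuasion_strategy X (repeated_revelation s N)"
  unfolding persuasion_strategy_def terminates_def
proof (intro conjI allI)
  show "\<forall>h\<in>lists X. \<forall>I. repeated_revelation s N h = Some I \<longrightarrow> info_structure_on X I"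
    using assms by (auto simp: repeated_revelation_def info_structure_on_def)
  show "\<exists>n. \<not> possible_history (repeated_revelation s N) \<omega> (map x [0..<n])" for \<omega> x
    \<comment> \<open>Possible histories may have length \<open>N\<close> itself, so
      \<open>Suc N\<close> is the first length that excludes every sequence.\<close>
    by (rule exI[of _ "Suc N"]) (simp add: possible_history_repeated_revelation)
qed

lemma terminal_histories_repeated_revelation:
  "terminal_histories (repeated_revelation s N) \<omega> = {replicate N (s \<omega>)}"
proof -
  have "repeated_revelation s N h = None \<longleftrightarrow> N \<le> length h" for h
    by (simp add: repeated_revelation_def)
  then have "h \<in> terminal_histories (repeated_revelation s N) \<omega> \<longleftrightarrow>
      length h = N \<and> (\<forall>y\<in>set h. y = s \<omega>)" for h
    by (auto simp: terminal_histories_def possible_history_repeated_revelation)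
  also have "length h = N \<and> (\<forall>y\<in>set h. y = s \<omega>) \<longleftrightarrow> h = replicate N (s \<omega>)" for h
    using replicate_eqI[of h N "s \<omega>"] by auto
  finally show ?thesis by blast
qed

text \<open>Every round produces the posterior \<open>point_belief \<omega>\<close>, whatever the
  current belief. The induction runs over \<open>k\<close> with the strategy fixed;
  \<open>k \<le> N\<close> ensures that it has not stopped before round \<open>k\<close>.\<close>

lemma receiver_belief_repeated_revelation:
  assumes "interior_bias D" "\<mu>0 \<in> full_support_beliefs" "inj s" "k \<le> N"
  shows "receiver_belief D \<mu>0 (repeated_revelation s N) (replicate k (s \<omega>)) =
    bias_iterate D k \<mu>0 (point_belief \<omega>)"
  using assms(4)
proof (induction k)
  case 0
  then show ?case by (simp add: receiver_belief_Nil bias_iterate_def)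
next
  case (Suc k)
  have "bias_iterate D k \<mu>0 (point_belief \<omega>) \<in> full_support_beliefs"
    by (intro bias_iterate_full_support assms point_belief_in_beliefs)
  then have "receiver_belief D \<mu>0 (repeated_revelation s N) (replicate k (s \<omega>) @ [s \<omega>]) =
      bias_iterate D (Suc k) \<mu>0 (point_belief \<omega>)"
    using Suc
    by (simp add: receiver_belief_snoc repeated_revelation_def[of s N "replicate k (s \<omega>)"]
        bayes_posterior_revealing[OF _ assms(3)] bias_iterate_def)
  then show ?case by (simp add: replicate_append_same)
qed

lemma sequential_payoff_repeated_revelation:
  fixes D :: "'w::finite bias" and s :: "'w \<Rightarrow> 'x"
  assumes "interior_bias D" "\<mu>0 \<in> full_support_beliefs" "inj s"
  shows "sequential_payoff D v ahat \<mu>0 (repeated_revelation s N) =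
    belief_expectation \<mu>0 (\<lambda>\<omega>. v \<omega> (ahat (bias_iterate D N \<mu>0 (point_belief \<omega>))))"
proof -
  \<comment> \<open>Terminal probabilities sum to 1, and there is only one terminal history.\<close>
  have "history_prob (repeated_revelation s N) \<omega> (replicate N (s \<omega>)) = 1" for \<omega>
    using sum_history_prob_terminal[OF persuasion_strategy_repeated_revelation[OF subset_UNIV], of s N \<omega>]
    by (simp add: terminal_histories_repeated_revelation)
  then show ?thesis
    by (simp add: sequential_payoff_def terminal_histories_repeated_revelation
        receiver_belief_repeated_revelation[OF assms])
qed

section \<open>Convergence of utility near a point belief\<close>

text \<open>The chosen action itself may keep changing as the beliefs converge; only its utility in
  state \<open>\<omega>\<close> is controlled.\<close>

lemma tendsto_receiver_choice_utility:
  fixes u :: "'w::finite \<Rightarrow> 'a \<Rightarrow> real"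
  assumes rc: "receiver_choice A u v ahat"
    and full: "\<And>n. \<rho> n \<in> full_support_beliefs"
    and lim: "(\<rho> \<longlongrightarrow> point_belief \<omega>) F"
  shows "((\<lambda>n. u \<omega> (ahat (\<rho> n))) \<longlongrightarrow> u \<omega> (ahat (point_belief \<omega>))) F"
proof -
  define m where "m \<omega>' = u \<omega>' (ahat (point_belief \<omega>'))" for \<omega>'
  define b where "b = ahat (point_belief \<omega>)"
  define loss where "loss a \<omega>' = m \<omega>' - u \<omega>' a" for a \<omega>'
  have b: "b \<in> A" unfolding b_def by (rule receiver_choice_mem[OF rc point_belief_in_beliefs])
  have loss_nonneg: "0 \<le> loss a \<omega>'" if "a \<in> A" for a \<omega>'
    using receiver_choice_point_belief_optimal[OF rc that] by (simp add: loss_def m_def)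
  have \<rho>: "\<rho> n \<in> beliefs" for n using full full_support_beliefs_subset_beliefs by blast
  have pos: "0 < \<rho> n $ \<omega>'" for n \<omega>' using full by (simp add: full_support_beliefs_def)
  have nonneg: "0 \<le> loss (ahat (\<rho> n)) \<omega>'" for n \<omega>'
    by (intro loss_nonneg receiver_choice_mem[OF rc \<rho>])
  have upper: "loss (ahat (\<rho> n)) \<omega> \<le> belief_expectation (\<rho> n) (loss b) / \<rho> n $ \<omega>" for n
  proof -
    \<comment> \<open>All terms of the expected loss are nonnegative, so the one for
      \<open>\<omega>\<close> is at most the whole.\<close>
    have "\<rho> n $ \<omega> * loss (ahat (\<rho> n)) \<omega> \<le> belief_expectation (\<rho> n) (loss (ahat (\<rho> n)))"
      unfolding belief_expectation_def
      using pos nonneg by (intro member_le_sum) (auto simp: less_imp_le)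
    \<comment> \<open>The expectation of \<open>m\<close> is common to both sides, so maximizing
      expected utility minimizes expected loss.\<close>
    also have "\<dots> \<le> belief_expectation (\<rho> n) (loss b)"
      using receiver_choice_optimal[OF rc \<rho> b, of n]
      by (simp add: belief_expectation_def loss_def right_diff_distrib sum_subtractf)
    finally show ?thesis using pos[of n \<omega>] by (simp add: pos_le_divide_eq mult.commute)
  qed
  \<comment> \<open>The denominator tends to 1 and the numerator to \<open>loss b \<omega>\<close>,
    which is 0 by the choice of \<open>b\<close>.\<close>
  have "((\<lambda>n. belief_expectation (\<rho> n) (loss b) / \<rho> n $ \<omega>) \<longlongrightarrow>
      belief_expectation (point_belief \<omega>) (loss b) / point_belief \<omega> $ \<omega>) F"
    by (intro tendsto_intros tendsto_belief_expectation lim) (simp add: point_belief_def axis_def)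
  then have "((\<lambda>n. belief_expectation (\<rho> n) (loss b) / \<rho> n $ \<omega>) \<longlongrightarrow> 0) F"
    by (simp add: belief_expectation_point_belief loss_def m_def b_def)
  then have "((\<lambda>n. loss (ahat (\<rho> n)) \<omega>) \<longlongrightarrow> 0) F"
    by (rule tendsto_sandwich[rotated 3]) (auto simp: nonneg upper)
  then have "((\<lambda>n. m \<omega> - loss (ahat (\<rho> n)) \<omega>) \<longlongrightarrow> m \<omega> - 0) F"
    by (intro tendsto_intros)
  then show ?thesis by (simp add: loss_def m_def)
qed

section \<open>The equivalence\<close>

theorem proposition3:
  fixes A :: "'a set" and u v :: "'w::finite \<Rightarrow> 'a \<Rightarrow> real"
    and ahat :: "real ^ 'w \<Rightarrow> 'a"
    and \<mu>0 :: "real ^ 'w" and D :: "'w bias" and X :: "'x set"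
  assumes "\<mu>0 \<in> full_support_beliefs"
    and "infinite X"
    and "receiver_choice A u v ahat"
    and "bias_function D"
    and "one_shot_max_attained D v ahat \<mu>0"
    and "\<And>\<omega> a. a \<in> A \<Longrightarrow> u \<omega> a = v \<omega> a"
    and "interior_bias D"
    and "eventual_learning_of_states D"
  shows "gains_from_sequential_persuasion X D v ahat \<mu>0 \<longleftrightarrow>
    one_shot_value D v ahat \<mu>0 < (\<Sum>\<omega>\<in>UNIV. \<mu>0 $ \<omega> * (SUP a\<in>A. v \<omega> a))"
proof -
  note rc = assms(3)
  define m where "m \<omega> = v \<omega> (ahat (point_belief \<omega>))" for \<omega>
  have mem: "ahat \<mu> \<in> A" if "\<mu> \<in> beliefs" for \<mu>
    by (rule receiver_choice_mem[OF rc that])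
  \<comment> \<open>Preferences are assumed equal on \<open>A\<close> only, so \<open>u\<close> and
    \<open>v\<close> are exchanged only at actions known to lie there.\<close>
  have common: "u \<omega> (ahat \<mu>) = v \<omega> (ahat \<mu>)" if "\<mu> \<in> beliefs" for \<omega> \<mu>
    by (rule assms(6)[OF mem[OF that]])
  have max: "v \<omega> a \<le> m \<omega>" if "a \<in> A" for \<omega> a
    using receiver_choice_point_belief_optimal[OF rc that, of \<omega>] that
    by (simp add: assms(6) common[OF point_belief_in_beliefs] m_def)
  \<comment> \<open>The supremum is a maximum, attained at the action chosen under certainty of
    \<open>\<omega>\<close>.\<close>
  have "(SUP a\<in>A. v \<omega> a) = m \<omega>" for \<omega>
    using mem[OF point_belief_in_beliefs] max by (intro cSup_eq_maximum) (auto simp: m_def)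
  then have full_info: "(\<Sum>\<omega>\<in>UNIV. \<mu>0 $ \<omega> * (SUP a\<in>A. v \<omega> a)) = belief_expectation \<mu>0 m"
    by (simp add: belief_expectation_def)
  show ?thesis
    unfolding full_info
  proof
    assume "gains_from_sequential_persuasion X D v ahat \<mu>0"
    then obtain \<sigma> where "persuasion_strategy X \<sigma>"
      "one_shot_value D v ahat \<mu>0 < sequential_payoff D v ahat \<mu>0 \<sigma>"
      by (auto simp: gains_from_sequential_persuasion_def)
    then show "one_shot_value D v ahat \<mu>0 < belief_expectation \<mu>0 m"
      using sequential_payoff_le[OF _ assms(7,1), of X \<sigma> v ahat m] max mem by fastforce
  next
    assume less: "one_shot_value D v ahat \<mu>0 < belief_expectation \<mu>0 m"
    \<comment> \<open>An infinite \<open>X\<close> contains a distinct signal for each of the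
      finitely many states.\<close>
    obtain s :: "'w \<Rightarrow> 'x" where s: "inj s" "range s \<subseteq> X"
      using infinite_arbitrarily_large[OF assms(2), of "CARD('w)"]
      by (metis card_le_inj finite order_refl subset_trans)
    let ?\<rho> = "\<lambda>\<omega> n. bias_iterate D n \<mu>0 (point_belief \<omega>)"
    have full: "?\<rho> \<omega> n \<in> full_support_beliefs" for \<omega> n
      by (intro bias_iterate_full_support assms point_belief_in_beliefs)
    then have bel: "?\<rho> \<omega> n \<in> beliefs" for \<omega> n
      using full_support_beliefs_subset_beliefs by blast
    have "(\<lambda>n. u \<omega> (ahat (?\<rho> \<omega> n))) \<longlonglongrightarrow> u \<omega> (ahat (point_belief \<omega>))" for \<omega>
      using assms(1,8) by (intro tendsto_receiver_choice_utility[OF rc full])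
        (simp add: eventual_learning_of_states_def)
    then have "(\<lambda>n. v \<omega> (ahat (?\<rho> \<omega> n))) \<longlonglongrightarrow> m \<omega>" for \<omega>
      by (simp only: m_def common[OF bel] common[OF point_belief_in_beliefs])
    then have "(\<lambda>n. belief_expectation \<mu>0 (\<lambda>\<omega>. v \<omega> (ahat (?\<rho> \<omega> n)))) \<longlonglongrightarrow> belief_expectation \<mu>0 m"
      unfolding belief_expectation_def by (intro tendsto_intros)
    \<comment> \<open>The strict gap lets a finite number of rounds suffice, even if the
      full-information payoff is reached only in the limit.\<close>
    then have "eventually (\<lambda>n. one_shot_value D v ahat \<mu>0 <
        belief_expectation \<mu>0 (\<lambda>\<omega>. v \<omega> (ahat (?\<rho> \<omega> n)))) sequentially"
      using less by (rule order_tendstoD)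
    then obtain N where "one_shot_value D v ahat \<mu>0 <
        belief_expectation \<mu>0 (\<lambda>\<omega>. v \<omega> (ahat (?\<rho> \<omega> N)))"
      by (auto simp: eventually_sequentially)
    then show "gains_from_sequential_persuasion X D v ahat \<mu>0"
      unfolding gains_from_sequential_persuasion_def
      using persuasion_strategy_repeated_revelation[OF s(2)]
        sequential_payoff_repeated_revelation[OF assms(7,1) s(1)] by metis
  qed
qed

end
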